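(* Let $\alpha,\beta\in(0,1)$. The transient change-point detection and estimation scheme described in the context, with thresholds $$h_\alpha=-\log\frac{\alpha}{E_F(e^{W_n})},\qquad \widetilde h_\beta=-\log\frac{\beta}{E_G(e^{\widetilde W_n})},$$ resulting in the estimator $\{\widehat a_k,\widehat b_k\}_{k=1}^{\widehat K}$, controls the familywise rates of false alarms and false readjustments at levels $$\mathrm{FAR}\le\alpha\quad\text{and}\quad\mathrm{FRR}\le\beta$$ for any unknown number of transient changes $K$.
   Context: Model: $X_1,\dots,X_n$ are independent; there are $K$ transient change intervals with unknown change-points $a_1<b_1<a_2<b_2<\dots<a_K<b_K$, such that $X_i\sim G$ for $a_k<i\le b_k$ ($k=1,\dots,K$) and $X_i\sim F$ otherwise. $F$, $G$ are known distributions with densities $f$, $g$ with respect to a reference measure. $K$ is unknown. $E_F$ (resp. $E_G$) is expectation when $X_1,\dots,X_n$ are all i.i.d. from $F$ (resp. $G$). Let $S_t=\sum_{i=1}^t\log\frac{g(X_i)}{f(X_i)}$, $S_0=0$. For a (random) time $T\ge0$ define the renewed CUSUM processes $$W_{T,t}=S_{T+t}-\min_{0\le i\le t}S_{T+i},\qquad \widetilde W_{T,t}=\max_{0\le i\le t}S_{T+i}-S_{T+t},$$ and $W_t=W_{0,t}$, $\widetilde W_t=\widetilde W_{0,t}$. For a process $V_t$, $\mathrm{Ker}\,V=\{t:V_t=0\}$. Scheme: set $$\tau_1=\inf\{t:0<t\le n,\ W_t\ge h_\alpha\},\quad \widehat a_1=\max\{\mathrm{Ker}\,W_t\cap[0,\tau_1)\},$$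 and then, for $k\ge 1$ (in the first line) and $k\ge2$ (in the second line), $$\widetilde\tau_k=\tau_k+\inf\{t:0<t\le n-\tau_k,\ \widetilde W_{\tau_k,t}\ge\widetilde h_\beta\},\quad \widehat b_k=\tau_k+\max\{\mathrm{Ker}\,\widetilde W_{\tau_k,t}\cap[0,\widetilde\tau_k-\tau_k)\},$$ $$\tau_k=\widetilde\tau_{k-1}+\inf\{t:0<t\le n-\widetilde\tau_{k-1},\ W_{\widetilde\tau_{k-1},t}\ge h_\alpha\},\quad \widehat a_k=\widetilde\tau_{k-1}+\max\{\mathrm{Ker}\,W_{\widetilde\tau_{k-1},t}\cap[0,\tau_k-\widetilde\tau_{k-1})\},$$ sequentially until $\tau_k=\infty$ or $\widetilde\tau_k=\infty$ ($\inf\varnothing=\infty$). $\widehat K$ is the number of detected intervals. Error rates (the unions over $k$ run over the intervals produced by the scheme): $$\mathrm{FAR}=P\Bigl\{\bigcup_k\Bigl([\widehat a_k,\widehat b_k]\cap\bigcup_j[a_j,b_j]=\varnothing\Bigr)\Bigr\},\qquad \mathrm{FRR}=P\Bigl\{\bigcup_k\Bigl([\widehat b_k,\widehat a_{k+1}]\cap\bigcup_j[b_j,a_{j+1}]=\varnothing\Bigr)\Bigr\},$$ where the $[b_j,a_{j+1}]$ are the true in-control intervals, including the initial and final ones ($b_0=0$, $a_{K+1}=n$). That is, a false alarm is an estimated change interval that meets no disorder region, and a false readjustment is an estimated in-control interval containing no in-control observations. *)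

theory Defs
  imports "HOL-Probability.Probability" "HOL-Library.Extended_Nat"
begin

text \<open>
  Sample paths are functions on the naturals; only the observations with index in
  \<open>{1..n}\<close> are ever used. The densities are assumed (in the theorem) to be positive on the
  same set up to a null set, so that the total functions \<open>ln\<close> and \<open>/\<close> give the genuine, finite
  log-likelihood ratio almost surely.
\<close>

definition llr_walk :: "('b \<Rightarrow> real) \<Rightarrow> ('b \<Rightarrow> real) \<Rightarrow> (nat \<Rightarrow> 'b) \<Rightarrow> nat \<Rightarrow> real" where
  "llr_walk f g x t = (\<Sum>i = 1..t. ln (g (x i) / f (x i)))"

definition cusum :: "(nat \<Rightarrow> real) \<Rightarrow> nat \<Rightarrow> nat \<Rightarrow> real" where
  "cusum S T t = S (T + t) - Min ((\<lambda>i. S (T + i)) ` {0..t})"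

definition cusum_rev :: "(nat \<Rightarrow> real) \<Rightarrow> nat \<Rightarrow> nat \<Rightarrow> real" where
  "cusum_rev S T t = Max ((\<lambda>i. S (T + i)) ` {0..t}) - S (T + t)"

text \<open>On \<^typ>\<open>enat\<close> the infimum of the empty set is \<open>\<infinity>\<close>.\<close>

definition first_passage :: "nat \<Rightarrow> (nat \<Rightarrow> real) \<Rightarrow> real \<Rightarrow> enat" where
  "first_passage m V h = Inf (enat ` {t. 0 < t \<and> t \<le> m \<and> h \<le> V t})"

definition last_zero_before :: "nat \<Rightarrow> (nat \<Rightarrow> real) \<Rightarrow> enat \<Rightarrow> nat" where
  "last_zero_before m V s = Max {t. t \<le> m \<and> V t = 0 \<and> enat t < s}"

text \<open>
  One stage of the scheme: the process \<open>V\<close> is restarted at a (possibly infinite) time.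
  Once a time is infinite, all later ones are.
\<close>

definition next_time :: "nat \<Rightarrow> (nat \<Rightarrow> nat \<Rightarrow> real) \<Rightarrow> real \<Rightarrow> enat \<Rightarrow> enat" where
  "next_time n V h T =
     (case T of enat m \<Rightarrow> enat m + first_passage (n - m) (V m) h | \<infinity> \<Rightarrow> \<infinity>)"

text \<open>
  \<open>tau_tilde\<close> and \<open>tau\<close> are the readjustment and alarm times. Starting from
  \<open>tau_tilde 0 = 0\<close> makes the first alarm time an instance of the general rule;
  \<open>tau\<close> and \<open>a_hat\<close> are meaningful for indices \<open>k \<ge> 1\<close> only.
\<close>

primrec tau_tilde :: "nat \<Rightarrow> (nat \<Rightarrow> real) \<Rightarrow> real \<Rightarrow> real \<Rightarrow> nat \<Rightarrow> enat" where
  "tau_tilde n S h h' 0 = 0"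
| "tau_tilde n S h h' (Suc k) =
     next_time n (cusum_rev S) h' (next_time n (cusum S) h (tau_tilde n S h h' k))"

definition tau :: "nat \<Rightarrow> (nat \<Rightarrow> real) \<Rightarrow> real \<Rightarrow> real \<Rightarrow> nat \<Rightarrow> enat" where
  "tau n S h h' k = next_time n (cusum S) h (tau_tilde n S h h' (k - 1))"

text \<open>
  If the stopping time that closes a stage is infinite, the estimated change-point of that
  stage is the last zero of the process on the whole remaining sample.
\<close>

definition a_hat :: "nat \<Rightarrow> (nat \<Rightarrow> real) \<Rightarrow> real \<Rightarrow> real \<Rightarrow> nat \<Rightarrow> nat" where
  "a_hat n S h h' k =
     (let T = the_enat (tau_tilde n S h h' (k - 1))
      in T + last_zero_before (n - T) (cusum S T) (tau n S h h' k - enat T))"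

definition b_hat :: "nat \<Rightarrow> (nat \<Rightarrow> real) \<Rightarrow> real \<Rightarrow> real \<Rightarrow> nat \<Rightarrow> nat" where
  "b_hat n S h h' k =
     (if k = 0 then 0
      else let T = the_enat (tau n S h h' k)
           in T + last_zero_before (n - T) (cusum_rev S T) (tau_tilde n S h h' k - enat T))"

definition K_hat :: "nat \<Rightarrow> (nat \<Rightarrow> real) \<Rightarrow> real \<Rightarrow> real \<Rightarrow> nat" where
  "K_hat n S h h' = card {k. 1 \<le> k \<and> tau n S h h' k < \<infinity>}"

definition false_alarm ::
  "nat \<Rightarrow> (nat \<Rightarrow> real) \<Rightarrow> real \<Rightarrow> real \<Rightarrow> nat \<Rightarrow> (nat \<Rightarrow> nat) \<Rightarrow> (nat \<Rightarrow> nat) \<Rightarrow> bool" where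
  "false_alarm n S h h' K a b \<longleftrightarrow>
     (\<exists>k\<in>{1..K_hat n S h h'}.
        {a_hat n S h h' k..b_hat n S h h' k} \<inter> (\<Union>j\<in>{1..K}. {a j..b j}) = {})"

text \<open>
  The true in-control intervals run from \<open>b j\<close> to \<open>a (j + 1)\<close> for \<open>j = 0, \<dots>, K\<close>, with
  \<open>b 0\<close> read as \<open>0\<close> and \<open>a (K + 1)\<close> as \<open>n\<close>.

  The estimated in-control intervals are those that follow a finite readjustment time, and
  the initial one. If no alarm follows the last readjustment, its interval is still closed by
  the value of \<open>a_hat\<close>; closing it by \<open>n\<close> instead would enlarge it, hence could only make the
  false readjustment event smaller.
\<close>

definition in_control_region :: "nat \<Rightarrow> nat \<Rightarrow> (nat \<Rightarrow> nat) \<Rightarrow> (nat \<Rightarrow> nat) \<Rightarrow> nat set" where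
  "in_control_region n K a b =
     (\<Union>j\<in>{0..K}. {(if j = 0 then 0 else b j)..(if j = K then n else a (j + 1))})"

definition false_readjustment ::
  "nat \<Rightarrow> (nat \<Rightarrow> real) \<Rightarrow> real \<Rightarrow> real \<Rightarrow> nat \<Rightarrow> (nat \<Rightarrow> nat) \<Rightarrow> (nat \<Rightarrow> nat) \<Rightarrow> bool" where
  "false_readjustment n S h h' K a b \<longleftrightarrow>
     (\<exists>k\<in>{0..K_hat n S h h'}. tau_tilde n S h h' k < \<infinity> \<and>
        {b_hat n S h h' k..a_hat n S h h' (k + 1)} \<inter> in_control_region n K a b = {})"

definition FAR ::
  "'a measure \<Rightarrow> ('b \<Rightarrow> real) \<Rightarrow> ('b \<Rightarrow> real) \<Rightarrow> nat \<Rightarrow> (nat \<Rightarrow> 'a \<Rightarrow> 'b) \<Rightarrow> real \<Rightarrow> real \<Rightarrow>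
   nat \<Rightarrow> (nat \<Rightarrow> nat) \<Rightarrow> (nat \<Rightarrow> nat) \<Rightarrow> real" where
  "FAR M f g n X h h' K a b =
     measure M {\<omega> \<in> space M. false_alarm n (llr_walk f g (\<lambda>i. X i \<omega>)) h h' K a b}"

definition FRR ::
  "'a measure \<Rightarrow> ('b \<Rightarrow> real) \<Rightarrow> ('b \<Rightarrow> real) \<Rightarrow> nat \<Rightarrow> (nat \<Rightarrow> 'a \<Rightarrow> 'b) \<Rightarrow> real \<Rightarrow> real \<Rightarrow>
   nat \<Rightarrow> (nat \<Rightarrow> nat) \<Rightarrow> (nat \<Rightarrow> nat) \<Rightarrow> real" where
  "FRR M f g n X h h' K a b =
     measure M {\<omega> \<in> space M. false_readjustment n (llr_walk f g (\<lambda>i. X i \<omega>)) h h' K a b}"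

text \<open>
  \<open>E_iid \<mu> p n \<Phi>\<close> is the expectation of a functional of the sample when the \<open>n\<close> observations
  are independent with common density \<open>p\<close>.
\<close>

definition E_iid :: "'b measure \<Rightarrow> ('b \<Rightarrow> real) \<Rightarrow> nat \<Rightarrow> ((nat \<Rightarrow> 'b) \<Rightarrow> real) \<Rightarrow> real" where
  "E_iid \<mu> p n \<Phi> = (\<integral>x. \<Phi> x \<partial>(PiM {1..n} (\<lambda>_. density \<mu> (\<lambda>y. ennreal (p y)))))"

definition h_alarm :: "'b measure \<Rightarrow> ('b \<Rightarrow> real) \<Rightarrow> ('b \<Rightarrow> real) \<Rightarrow> nat \<Rightarrow> real \<Rightarrow> real" where
  "h_alarm \<mu> f g n \<alpha> =
     - ln (\<alpha> / E_iid \<mu> f n (\<lambda>x. exp (cusum (llr_walk f g x) 0 n)))"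

definition h_readjust :: "'b measure \<Rightarrow> ('b \<Rightarrow> real) \<Rightarrow> ('b \<Rightarrow> real) \<Rightarrow> nat \<Rightarrow> real \<Rightarrow> real" where
  "h_readjust \<mu> f g n \<beta> =
     - ln (\<beta> / E_iid \<mu> g n (\<lambda>x. exp (cusum_rev (llr_walk f g x) 0 n)))"

end

theory Submission imports Defs begin

text \<open>
  Let \<open>S\<close> be the log-likelihood ratio walk. When the scheme raises its \<open>k\<close>-th alarm, the walk has
  climbed by at least \<open>h\<close> since the estimated change-point \<open>a_hat k\<close>, because a zero of the CUSUM
  process is a running minimum of the walk (\<open>increment_since_last_zero\<close>). The estimated interval
  reaches from there at least to the alarm time. If it meets no disorder interval, then the climb took
  place over observations from \<open>F\<close> only (\<open>false_alarm_imp_rise\<close>). So all false alarms, however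
  many there are, are contained in one event: that the walk climbs by \<open>h\<close> over some stretch of
  observations from \<open>F\<close>.

  This event depends on the \<open>F\<close>-observations only, hence has the same probability if the other
  observations are replaced by independent ones from \<open>F\<close> as well
  (\<open>prob_rise_within_le\<close>). In that sample it forces the CUSUM process \<open>W\<close> to reach \<open>h\<close>.
  Under \<open>F\<close> the process \<open>exp W\<close> is a submartingale, since \<open>exp S\<close> is a martingale. Doob's maximal
  inequality (\<open>emeasure_W_reaches_le\<close>) bounds the probability by \<open>exp (- h)\<close> times the expectation
  of \<open>exp (W n)\<close>, which is \<open>\<alpha>\<close> by the choice of \<open>h\<close>.

  False readjustments are treated by the same argument with \<open>- S\<close> for \<open>S\<close> and \<open>G\<close> for \<open>F\<close>:
  the reversed CUSUM process of \<open>S\<close> is the CUSUM process of \<open>- S\<close>, and \<open>exp (- S)\<close> is a martingale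
  under \<open>G\<close>. The probabilistic part is therefore carried out once, for a general score.
\<close>

section \<open>Pathwise properties of the scheme\<close>

lemma cusum_ge_increment: "i \<le> t \<Longrightarrow> S (T + t) - S (T + i) \<le> cusum S T t"
  unfolding cusum_def by (auto intro!: Min_le)

lemma cusum_eq_increment: "\<exists>i\<le>t. cusum S T t = S (T + t) - S (T + i)"
proof -
  have "Min ((\<lambda>i. S (T + i)) ` {0..t}) \<in> (\<lambda>i. S (T + i)) ` {0..t}"
    by (rule Min_in) auto
  then obtain i where "i \<in> {0..t}" "Min ((\<lambda>i. S (T + i)) ` {0..t}) = S (T + i)"
    by (elim imageE)
  then show ?thesis unfolding cusum_def by auto
qed

lemma cusum_rev_eq_cusum_uminus: "cusum_rev S = cusum (\<lambda>i. - S i)"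
proof (intro ext)
  fix T t
  have "- Max ((\<lambda>i. S (T + i)) ` {0..t}) = Min ((\<lambda>i. - S (T + i)) ` {0..t})"
    by (subst minus_Max_eq_Min) (simp_all add: image_image del: minus_Max_eq_Min minus_Min_eq_Max)
  then show "cusum_rev S T t = cusum (\<lambda>i. - S i) T t"
    unfolding cusum_def cusum_rev_def by linarith
qed

lemma next_time_finiteE:
  assumes "next_time n V h T < \<infinity>"
  obtains m t where "T = enat m" "next_time n V h T = enat (m + t)"
    "0 < t" "m + t \<le> n" "h \<le> V m t"
proof -
  obtain m where T: "T = enat m"
    using assms unfolding next_time_def by (cases T) auto
  let ?A = "{t. 0 < t \<and> t \<le> n - m \<and> h \<le> V m t}"
  have N: "next_time n V h T = enat m + Inf (enat ` ?A)"
    unfolding next_time_def first_passage_def T by simp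
  have ne: "enat ` ?A \<noteq> {}"
  proof
    assume "enat ` ?A = {}"
    then have "Inf (enat ` ?A) = \<infinity>" by (simp only: Inf_empty top_enat_def)
    with N assms show False by simp
  qed
  then have "Inf (enat ` ?A) \<in> enat ` ?A"
    by (meson ex_in_conv wellorder_InfI)
  then obtain t where t: "t \<in> ?A" "Inf (enat ` ?A) = enat t" by auto
  show ?thesis
    by (rule that[OF T, of t]) (use t N in auto)
qed

text \<open>
  Between the last zero of a CUSUM process and its passage over a positive level, the walk
  climbs by at least that level: the running minimum at the passage time is attained at a zero
  of the process, which differs from the passage time because the level is positive. Hence that
  minimum is still the value of the walk at the last zero.
\<close>

lemma increment_since_last_zero:
  assumes h: "0 < h" and U: "U = next_time n (cusum S) h T" and fin: "U < \<infinity>"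
  obtains m z t where "T = enat m" "U = enat t"
    "m + last_zero_before (n - m) (cusum S m) (U - enat m) = z"
    "m \<le> z" "z < t" "t \<le> n" "h \<le> S t - S z"
proof -
  obtain m d where T: "T = enat m" and N: "U = enat (m + d)"
    and d: "0 < d" "m + d \<le> n" "h \<le> cusum S m d"
    using next_time_finiteE[OF fin[unfolded U]] unfolding U by blast
  let ?Z = "{t. t \<le> n - m \<and> cusum S m t = 0 \<and> enat t < enat d}"
  define l where "l = Max ?Z"
  have finZ: "finite ?Z" by (rule finite_subset[of _ "{..n - m}"]) auto
  have "cusum S m 0 = 0" unfolding cusum_def by simp
  then have "0 \<in> ?Z" using d by auto
  then have "l \<in> ?Z" unfolding l_def using finZ by (intro Max_in) auto
  then have l: "cusum S m l = 0" "l < d" by auto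
  obtain i where i: "i \<le> d" "cusum S m d = S (m + d) - S (m + i)"
    using cusum_eq_increment by blast
  have "i \<noteq> d" using i d h by auto
  have "cusum S m i = 0"
  proof -
    obtain j where j: "j \<le> i" "cusum S m i = S (m + i) - S (m + j)"
      using cusum_eq_increment by blast
    have "S (m + i) \<le> S (m + j)"
      using cusum_ge_increment[of j d S m] i j by simp
    moreover have "0 \<le> cusum S m i" using cusum_ge_increment[of i i S m] by simp
    ultimately show ?thesis using j by simp
  qed
  then have "i \<in> ?Z" using i \<open>i \<noteq> d\<close> d by auto
  then have "i \<le> l" unfolding l_def using finZ by (intro Max_ge)
  then have "S (m + l) \<le> S (m + i)" using cusum_ge_increment[of i l S m] l by simp
  then have rise: "h \<le> S (m + d) - S (m + l)" using i d by simp
  have "last_zero_before (n - m) (cusum S m) (U - enat m) = l"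
    unfolding last_zero_before_def l_def N by simp
  then show ?thesis
    using that[of m "m + d" "m + l"] T N d l rise by simp
qed

text \<open>
  Once infinite, the alarm times stay infinite; so if the \<open>k\<close>-th one is infinite, then fewer than
  \<open>k\<close> of them are finite.
\<close>

lemma tau_finite_if_le_K_hat:
  assumes k: "1 \<le> k" "k \<le> K_hat n S h h'"
  shows "tau n S h h' k < \<infinity>"
proof (rule ccontr)
  assume *: "\<not> tau n S h h' k < \<infinity>"
  have tau_Suc: "tau n S h h' (Suc j) = \<infinity>" if "1 \<le> j" "tau n S h h' j = \<infinity>" for j
    using that by (cases j) (simp_all add: tau_def next_time_def)
  have "tau n S h h' j = \<infinity>" if "k \<le> j" for j
    using that
  proof (induction j rule: dec_induct)
    case base then show ?case using * by simp
  next
    case (step j) then show ?case using \<open>1 \<le> k\<close> by (simp add: tau_Suc)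
  qed
  then have "{k. 1 \<le> k \<and> tau n S h h' k < \<infinity>} \<subseteq> {1..<k}"
    by (auto simp: not_le[symmetric])
  then have "K_hat n S h h' \<le> card {1..<k}"
    unfolding K_hat_def by (intro card_mono) auto
  then show False using k by simp
qed

lemma false_alarm_imp_rise:
  assumes h: "0 < h" and fa: "false_alarm n S h h' K a b"
  shows "\<exists>s t. s < t \<and> t \<le> n \<and> {s<..t} \<inter> (\<Union>j\<in>{1..K}. {a j..b j}) = {} \<and> h \<le> S t - S s"
proof -
  obtain k where k: "1 \<le> k" "k \<le> K_hat n S h h'"
    and disj: "{a_hat n S h h' k..b_hat n S h h' k} \<inter> (\<Union>j\<in>{1..K}. {a j..b j}) = {}"
    using fa unfolding false_alarm_def by auto
  obtain m z t where
    *: "tau_tilde n S h h' (k - 1) = enat m" "tau n S h h' k = enat t"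
      "m + last_zero_before (n - m) (cusum S m) (tau n S h h' k - enat m) = z"
      "z < t" "t \<le> n" "h \<le> S t - S z"
    using increment_since_last_zero[OF h tau_def tau_finite_if_le_K_hat[OF k]] by metis
  have "a_hat n S h h' k = z" unfolding a_hat_def using * by (simp add: Let_def)
  moreover have "t \<le> b_hat n S h h' k" unfolding b_hat_def using k * by (simp add: Let_def)
  ultimately have "{z<..t} \<subseteq> {a_hat n S h h' k..b_hat n S h h' k}" by auto
  with disj * show ?thesis by blast
qed

lemma false_readjustment_imp_drop:
  assumes h: "0 < h'" and fr: "false_readjustment n S h h' K a b"
  shows "\<exists>s t. s < t \<and> t \<le> n \<and> {s<..t} \<inter> in_control_region n K a b = {} \<and> h' \<le> S s - S t"
proof -
  obtain k where fin: "tau_tilde n S h h' k < \<infinity>"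
    and disj: "{b_hat n S h h' k..a_hat n S h h' (k + 1)} \<inter> in_control_region n K a b = {}"
    using fr unfolding false_readjustment_def by auto
  \<comment> \<open>The initial estimated interval contains the time \<open>0\<close>, which is in control.\<close>
  have "k \<noteq> 0"
  proof
    assume "k = 0"
    then have "0 \<in> {b_hat n S h h' k..a_hat n S h h' (k + 1)}" by (simp add: b_hat_def)
    moreover have "0 \<in> in_control_region n K a b"
      unfolding in_control_region_def by (auto intro!: bexI[of _ 0])
    ultimately show False using disj by blast
  qed
  then have eq: "tau_tilde n S h h' k
      = next_time n (cusum (\<lambda>i. - S i)) h' (tau n S h h' k)"
    by (cases k) (simp_all add: tau_def cusum_rev_eq_cusum_uminus)
  obtain m z t where
    *: "tau n S h h' k = enat m" "tau_tilde n S h h' k = enat t"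
      "m + last_zero_before (n - m) (cusum (\<lambda>i. - S i) m) (tau_tilde n S h h' k - enat m) = z"
      "z < t" "t \<le> n" and rise: "h' \<le> - S t - - S z"
    using increment_since_last_zero[OF h eq fin] by metis
  have drop: "h' \<le> S z - S t" using rise by simp
  have "b_hat n S h h' k = z"
    unfolding b_hat_def cusum_rev_eq_cusum_uminus using * \<open>k \<noteq> 0\<close> by (simp add: Let_def)
  moreover have "t \<le> a_hat n S h h' (k + 1)" unfolding a_hat_def using * by (simp add: Let_def)
  ultimately have "{z<..t} \<subseteq> {b_hat n S h h' k..a_hat n S h h' (k + 1)}" by auto
  with disj * drop show ?thesis by blast
qed

lemma in_disorder_if_not_in_control:
  assumes i: "i \<in> {1..n}" "i \<notin> in_control_region n K a b"
  shows "\<exists>k\<in>{1..K}. a k < i \<and> i \<le> b k"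
proof -
  have out: "\<not> ((if j = 0 then 0 else b j) \<le> i \<and> i \<le> (if j = K then n else a (j + 1)))"
    if "j \<le> K" for j
  proof
    assume "(if j = 0 then 0 else b j) \<le> i \<and> i \<le> (if j = K then n else a (j + 1))"
    then have "i \<in> in_control_region n K a b"
      unfolding in_control_region_def using that by (intro UN_I[of j]) (simp_all del: if_split)
    then show False using i by simp
  qed
  \<comment> \<open>The last disorder interval that starts before \<open>i\<close> contains \<open>i\<close>.\<close>
  define J where "J = {j\<in>{1..K}. a j < i}"
  define k where "k = Max J"
  have "K \<noteq> 0" using out[of 0] i by (cases "K = 0") simp_all
  then have "1 \<in> J" using out[of 0] i by (simp add: J_def)
  then have "k \<in> J" unfolding k_def by (intro Max_in) (auto simp: J_def)
  moreover have "i \<le> b k"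
  proof (rule ccontr)
    assume "\<not> i \<le> b k"
    then have "k \<noteq> K \<and> a (k + 1) < i"
      using out[of k] \<open>k \<in> J\<close> i by (auto simp: J_def split: if_splits)
    then have "k + 1 \<in> J" using \<open>k \<in> J\<close> by (auto simp: J_def)
    then have "k + 1 \<le> k" unfolding k_def by (intro Max_ge) (auto simp: J_def)
    then show False by simp
  qed
  ultimately show ?thesis by (auto simp: J_def)
qed

section \<open>A maximal inequality for the exponentiated CUSUM process\<close>

(* Keeps the index sets {1..n} of product measures in one syntactic form. *)
declare One_nat_def [simp del]

text \<open>
  The law \<open>D\<close> of one observation, together with a score \<open>\<phi>\<close> whose partial sums over independent
  observations form the walk. The normalisation says that \<open>exp \<phi>\<close> is a likelihood ratio with
  respect to \<open>D\<close>, which makes the exponentiated walk a martingale of mean one.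
\<close>

locale iid_score = prob_space D for D :: "'b measure" +
  fixes \<phi> :: "'b \<Rightarrow> real"
  assumes score_measurable [measurable]: "\<phi> \<in> borel_measurable D"
    and nn_integral_exp_score: "(\<integral>\<^sup>+y. ennreal (exp (\<phi> y)) \<partial>D) = 1"
begin

definition walk :: "(nat \<Rightarrow> 'b) \<Rightarrow> nat \<Rightarrow> real" where
  "walk x t = (\<Sum>i = 1..t. \<phi> (x i))"

text \<open>
  \<open>W\<close> is the CUSUM process of the walk; \<open>P I\<close> is the joint law of independent observations from
  \<open>D\<close> with indices in \<open>I\<close>.
\<close>

abbreviation W :: "nat \<Rightarrow> (nat \<Rightarrow> 'b) \<Rightarrow> real" where
  "W t x \<equiv> cusum (walk x) 0 t"

abbreviation P :: "nat set \<Rightarrow> (nat \<Rightarrow> 'b) measure" where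
  "P I \<equiv> PiM I (\<lambda>_. D)"

lemma product_prob_space_D: "product_prob_space (\<lambda>_::nat. D)"
  by unfold_locales

lemma walk_diff: "s \<le> t \<Longrightarrow> walk x t - walk x s = (\<Sum>i\<in>{s<..t}. \<phi> (x i))"
proof -
  assume "s \<le> t"
  then have "{1..t} = {1..s} \<union> {s<..t}" by auto
  then have "walk x t = walk x s + (\<Sum>i\<in>{s<..t}. \<phi> (x i))"
    unfolding walk_def by (simp add: sum.union_disjoint ivl_disj_int)
  then show ?thesis by simp
qed

lemma walk_restrict: "{1..t} \<subseteq> I \<Longrightarrow> walk (restrict x I) t = walk x t"
  unfolding walk_def by (intro sum.cong) auto

lemma W_restrict: "{1..t} \<subseteq> I \<Longrightarrow> W t (restrict x I) = W t x"
proof -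
  assume I: "{1..t} \<subseteq> I"
  have "walk (restrict x I) s = walk x s" if "s \<le> t" for s
    using I that by (intro walk_restrict) auto
  then have "walk (restrict x I) t = walk x t"
    "(\<lambda>i. walk (restrict x I) i) ` {0..t} = walk x ` {0..t}"
    by (auto intro!: image_cong)
  then show ?thesis unfolding cusum_def by simp
qed

lemma walk_measurable [measurable]:
  assumes "t \<le> n"
  shows "(\<lambda>x. walk x t) \<in> borel_measurable (P {1..n})"
  unfolding walk_def using assms by (intro borel_measurable_sum) simp

lemma W_measurable [measurable]:
  assumes "t \<le> n"
  shows "W t \<in> borel_measurable (P {1..n})"
proof -
  have [measurable]: "(\<lambda>x. walk x s) \<in> borel_measurable (P {1..n})" if "s \<in> {0..t}" for s
    using that assms by (intro walk_measurable) simp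
  then show ?thesis
    unfolding cusum_def add_0 by (intro borel_measurable_diff borel_measurable_Min) auto
qed

text \<open>
  Factors \<open>exp \<phi>\<close> of further coordinates do not change an integral over the first ones; this is
  the martingale property of the exponentiated walk.
\<close>

lemma nn_integral_mult_exp_score:
  assumes IJ: "I \<inter> J = {}" "finite I" "finite J"
    and \<Phi> [measurable]: "\<Phi> \<in> borel_measurable (P (I \<union> J))"
    and dep: "\<And>x. \<Phi> (restrict x I) = \<Phi> x"
  shows "(\<integral>\<^sup>+x. \<Phi> x * ennreal (exp (\<Sum>i\<in>J. \<phi> (x i))) \<partial>P (I \<union> J)) = (\<integral>\<^sup>+x. \<Phi> x \<partial>P (I \<union> J))"
proof -
  interpret product_prob_space "\<lambda>_::nat. D" J by (rule product_prob_space_D)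
  have merge: "\<Phi> (merge I J (x, y)) = \<Phi> x" for x y
    by (metis dep restrict_merge(1) IJ(1))
  have score: "(\<integral>\<^sup>+y. ennreal (exp (\<Sum>i\<in>J. \<phi> (y i))) \<partial>P J) = 1"
  proof -
    have "(\<integral>\<^sup>+y. ennreal (exp (\<Sum>i\<in>J. \<phi> (y i))) \<partial>P J)
        = (\<integral>\<^sup>+y. (\<Prod>i\<in>J. ennreal (exp (\<phi> (y i)))) \<partial>P J)"
      using IJ by (intro nn_integral_cong) (simp add: exp_sum prod_ennreal)
    also have "\<dots> = (\<Prod>i\<in>J. \<integral>\<^sup>+y. ennreal (exp (\<phi> y)) \<partial>D)"
      using IJ by (intro product_nn_integral_prod) auto
    also have "\<dots> = 1" by (simp add: nn_integral_exp_score)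
    finally show ?thesis .
  qed
  have "(\<integral>\<^sup>+x. \<Phi> x * ennreal (exp (\<Sum>i\<in>J. \<phi> (x i))) \<partial>P (I \<union> J))
      = (\<integral>\<^sup>+x. \<integral>\<^sup>+y. \<Phi> (merge I J (x, y)) *
          ennreal (exp (\<Sum>i\<in>J. \<phi> (merge I J (x, y) i))) \<partial>P J \<partial>P I)"
    by (intro product_nn_integral_fold IJ) measurable
  also have "\<dots> = (\<integral>\<^sup>+x. \<integral>\<^sup>+y. \<Phi> x * ennreal (exp (\<Sum>i\<in>J. \<phi> (y i))) \<partial>P J \<partial>P I)"
    using IJ by (intro nn_integral_cong) (auto simp: merge intro!: arg_cong2[where f="(*)"] sum.cong)
  also have "\<dots> = (\<integral>\<^sup>+x. \<Phi> x * (\<integral>\<^sup>+y. ennreal (exp (\<Sum>i\<in>J. \<phi> (y i))) \<partial>P J) \<partial>P I)"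
    by (intro nn_integral_cong nn_integral_cmult) measurable
  also have "\<dots> = (\<integral>\<^sup>+x. \<integral>\<^sup>+y. \<Phi> (merge I J (x, y)) \<partial>P J \<partial>P I)"
    unfolding score merge by (simp add: emeasure_space_1)
  also have "\<dots> = (\<integral>\<^sup>+x. \<Phi> x \<partial>P (I \<union> J))"
    by (intro product_nn_integral_fold[symmetric] IJ) measurable
  finally show ?thesis .
qed

lemma nn_integral_mult_exp_walk_diff:
  assumes "t \<le> n" and [measurable]: "\<Phi> \<in> borel_measurable (P {1..n})"
    and dep: "\<And>x. \<Phi> (restrict x {1..t}) = \<Phi> x"
  shows "(\<integral>\<^sup>+x. \<Phi> x * ennreal (exp (walk x n - walk x t)) \<partial>P {1..n}) = (\<integral>\<^sup>+x. \<Phi> x \<partial>P {1..n})"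
proof -
  have "{1..n} = {1..t} \<union> {t<..n}" using assms(1) by auto
  moreover have "{1..t} \<inter> {t<..n} = {}" by auto
  ultimately show ?thesis
    using nn_integral_mult_exp_score[of "{1..t}" "{t<..n}" \<Phi>] assms
    by (simp add: walk_diff)
qed

lemma W_ge_W_plus_walk_diff:
  assumes "t \<le> n"
  shows "W t x + (walk x n - walk x t) \<le> W n x"
proof -
  obtain i where "i \<le> t" "W t x = walk x (0 + t) - walk x (0 + i)"
    using cusum_eq_increment by blast
  then show ?thesis using cusum_ge_increment[of i n "walk x" 0] assms by simp
qed

text \<open>
  Doob's maximal inequality for the submartingale \<open>exp (W t)\<close>. On the event that the level \<open>h\<close>
  is first reached at time \<open>t\<close>, the final value dominates \<open>exp (W t)\<close> times a factor of mean one
  that depends on later observations only.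
\<close>

lemma emeasure_W_reaches_le:
  "ennreal (exp h) * emeasure (P {1..n}) {x\<in>space (P {1..n}). \<exists>t\<le>n. h \<le> W t x}
     \<le> (\<integral>\<^sup>+x. ennreal (exp (W n x)) \<partial>P {1..n})"
proof -
  let ?P = "P {1..n}"
  define first where "first t x \<longleftrightarrow> h \<le> W t x \<and> (\<forall>s<t. \<not> h \<le> W s x)" for t x
  define T where "T t = {x\<in>space ?P. first t x}" for t
  let ?E = "{x\<in>space ?P. \<exists>t\<le>n. h \<le> W t x}"
  have meas: "Measurable.pred ?P (first t)" if "t \<le> n" for t
  proof -
    have le: "Measurable.pred ?P (\<lambda>x. h \<le> W s x)" if "s \<le> t" for s
    proof -
      have [measurable]: "W s \<in> borel_measurable ?P"
        using that \<open>t \<le> n\<close> by (intro W_measurable) simp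
      show ?thesis by measurable
    qed
    have first: "first t = (\<lambda>x. h \<le> W t x \<and> (\<forall>s\<in>{..<t}. \<not> h \<le> W s x))"
      by (auto simp: first_def fun_eq_iff)
    show ?thesis unfolding first
      by (intro pred_intros_logic pred_intros_finite le) auto
  qed
  then have T_sets [measurable]: "T t \<in> sets ?P" if "t \<le> n" for t
    using that unfolding T_def by measurable
  have Wm [measurable]: "W n \<in> borel_measurable ?P" by (rule W_measurable) simp
  have disj: "disjoint_family_on T {..n}"
    unfolding disjoint_family_on_def T_def first_def by (auto simp: linorder_neq_iff)
  have E: "?E = (\<Union>t\<le>n. T t)"
  proof (intro equalityI subsetI)
    fix x assume x: "x \<in> ?E"
    then obtain t where t: "t \<le> n" "h \<le> W t x" by auto
    define m where "m = (LEAST t. h \<le> W t x)"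
    have "first m x" unfolding first_def m_def
      using t LeastI[of "\<lambda>t. h \<le> W t x"] by (auto dest: not_less_Least)
    moreover have "m \<le> n" unfolding m_def using t Least_le[of "\<lambda>t. h \<le> W t x" t] by simp
    ultimately show "x \<in> (\<Union>t\<le>n. T t)" using x by (auto simp: T_def)
  qed (auto simp: T_def first_def)
  have stage: "ennreal (exp h) * emeasure ?P (T t)
      \<le> (\<integral>\<^sup>+x. ennreal (exp (W n x)) * indicator (T t) x \<partial>?P)" if t: "t \<le> n" for t
  proof -
    let ?\<Phi> = "\<lambda>x. ennreal (exp (W t x)) * indicator {x. first t x} x"
    have Wt [measurable]: "W t \<in> borel_measurable ?P" using t by (rule W_measurable)
    have "(\<lambda>x. if first t x then ennreal (exp (W t x)) else 0) \<in> borel_measurable ?P"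
      using meas[OF t] by measurable
    then have \<Phi>m [measurable]: "?\<Phi> \<in> borel_measurable ?P"
      by (rule measurable_cong[THEN iffD1, rotated]) (simp add: indicator_def)
    have dep: "?\<Phi> (restrict x {1..t}) = ?\<Phi> x" for x
    proof -
      have "W s (restrict x {1..t}) = W s x" if "s \<le> t" for s
        using that by (intro W_restrict) auto
      then show ?thesis by (simp add: first_def indicator_def)
    qed
    have "ennreal (exp h) * emeasure ?P (T t) = (\<integral>\<^sup>+x. ennreal (exp h) * indicator (T t) x \<partial>?P)"
      using t T_sets by (intro nn_integral_cmult_indicator[symmetric]) simp
    also have "\<dots> \<le> (\<integral>\<^sup>+x. ?\<Phi> x \<partial>?P)"
      by (intro nn_integral_mono) (auto simp: T_def first_def indicator_def)
    also have "\<dots> = (\<integral>\<^sup>+x. ?\<Phi> x * ennreal (exp (walk x n - walk x t)) \<partial>?P)"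
      by (rule nn_integral_mult_exp_walk_diff[OF t \<Phi>m dep, symmetric])
    also have "\<dots> \<le> (\<integral>\<^sup>+x. ennreal (exp (W n x)) * indicator (T t) x \<partial>?P)"
    proof (intro nn_integral_mono)
      fix x assume x: "x \<in> space ?P"
      have "exp (W t x) * exp (walk x n - walk x t) \<le> exp (W n x)"
        using W_ge_W_plus_walk_diff[OF t, of x] by (simp add: exp_add[symmetric])
      then show "?\<Phi> x * ennreal (exp (walk x n - walk x t)) \<le> ennreal (exp (W n x)) * indicator (T t) x"
        using x by (simp add: indicator_def T_def ennreal_mult[symmetric])
    qed
    finally show ?thesis .
  qed
  have "ennreal (exp h) * emeasure ?P ?E = (\<Sum>t\<le>n. ennreal (exp h) * emeasure ?P (T t))"
    unfolding E using T_sets disj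
    by (subst sum_emeasure[symmetric]) (auto simp: sum_distrib_left)
  also have "\<dots> \<le> (\<Sum>t\<le>n. \<integral>\<^sup>+x. ennreal (exp (W n x)) * indicator (T t) x \<partial>?P)"
    using stage by (intro sum_mono) simp
  also have "\<dots> = (\<integral>\<^sup>+x. (\<Sum>t\<le>n. ennreal (exp (W n x)) * indicator (T t) x) \<partial>?P)"
    by (intro nn_integral_sum[symmetric]) simp
  also have "\<dots> = (\<integral>\<^sup>+x. ennreal (exp (W n x)) * indicator ?E x \<partial>?P)"
    unfolding E by (simp add: sum_distrib_left[symmetric] indicator_UN_disjoint[OF _ disj])
  also have "\<dots> \<le> (\<integral>\<^sup>+x. ennreal (exp (W n x)) \<partial>?P)"
    by (intro nn_integral_mono) (auto simp: indicator_def)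
  finally show ?thesis .
qed

text \<open>
  The exponentiated CUSUM value is one of the \<open>n + 1\<close> likelihood ratios
  \<open>exp (walk x n - walk x t)\<close>, each of which has mean one.
\<close>

lemma nn_integral_exp_W_finite: "(\<integral>\<^sup>+x. ennreal (exp (W n x)) \<partial>P {1..n}) < \<infinity>"
proof -
  interpret product_prob_space "\<lambda>_::nat. D" "{1..n}" by (rule product_prob_space_D)
  have "(\<integral>\<^sup>+x. ennreal (exp (W n x)) \<partial>P {1..n})
      \<le> (\<integral>\<^sup>+x. (\<Sum>t\<le>n. ennreal (exp (walk x n - walk x t))) \<partial>P {1..n})"
  proof (intro nn_integral_mono)
    fix x
    obtain i where "i \<le> n" "W n x = walk x (0 + n) - walk x (0 + i)"
      using cusum_eq_increment by blast
    then show "ennreal (exp (W n x)) \<le> (\<Sum>t\<le>n. ennreal (exp (walk x n - walk x t)))"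
      using member_le_sum[of i "{..n}" "\<lambda>t. ennreal (exp (walk x n - walk x t))"] by simp
  qed
  also have "\<dots> = (\<Sum>t\<le>n. \<integral>\<^sup>+x. ennreal (exp (walk x n - walk x t)) \<partial>P {1..n})"
    by (intro nn_integral_sum) simp
  also have "\<dots> = (\<Sum>t\<le>n. 1)"
    using nn_integral_mult_exp_walk_diff[of _ n "\<lambda>_. 1"]
    by (intro sum.cong) (simp_all add: P.emeasure_space_1)
  also have "\<dots> < \<infinity>" by (simp add: of_nat_less_top)
  finally show ?thesis .
qed

text \<open>The level at which the maximal inequality gives the bound \<open>\<alpha>\<close>.\<close>

definition level :: "nat \<Rightarrow> real \<Rightarrow> real" where
  "level n \<alpha> = - ln (\<alpha> / (\<integral>x. exp (W n x) \<partial>P {1..n}))"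

lemma integrable_exp_W: "integrable (P {1..n}) (\<lambda>x. exp (W n x))"
  using nn_integral_exp_W_finite[of n] W_measurable[of n n]
  by (intro integrableI_nonneg) auto

lemma integral_exp_W_ge_1: "1 \<le> (\<integral>x. exp (W n x) \<partial>P {1..n})"
proof -
  interpret product_prob_space "\<lambda>_::nat. D" "{1..n}" by (rule product_prob_space_D)
  have "0 \<le> W n x" for x using cusum_ge_increment[of n n "walk x" 0] by simp
  then have "(\<integral>x. 1 \<partial>P {1..n}) \<le> (\<integral>x. exp (W n x) \<partial>P {1..n})"
    by (intro integral_mono integrable_exp_W P.integrable_const) auto
  then show ?thesis by (simp add: P.prob_space)
qed

lemma level_pos: "0 < \<alpha> \<Longrightarrow> \<alpha> < 1 \<Longrightarrow> 0 < level n \<alpha>"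
  unfolding level_def using integral_exp_W_ge_1[of n] by simp

lemma prob_W_reaches_level_le:
  assumes "0 < \<alpha>"
  shows "measure (P {1..n}) {x\<in>space (P {1..n}). \<exists>t\<le>n. level n \<alpha> \<le> W t x} \<le> \<alpha>"
proof -
  interpret product_prob_space "\<lambda>_::nat. D" "{1..n}" by (rule product_prob_space_D)
  let ?m = "measure (P {1..n}) {x\<in>space (P {1..n}). \<exists>t\<le>n. level n \<alpha> \<le> W t x}"
  let ?e = "\<integral>x. exp (W n x) \<partial>P {1..n}"
  have e: "0 < ?e" using integral_exp_W_ge_1[of n] by simp
  have "(\<integral>\<^sup>+x. ennreal (exp (W n x)) \<partial>P {1..n}) = ennreal ?e"
    by (rule nn_integral_eq_integral[OF integrable_exp_W]) simp
  then have "ennreal (exp (level n \<alpha>) * ?m) \<le> ennreal ?e"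
    using emeasure_W_reaches_le[of "level n \<alpha>" n]
    unfolding P.emeasure_eq_measure by (simp add: ennreal_mult)
  then have "exp (level n \<alpha>) * ?m \<le> ?e" using e by simp
  moreover have "exp (level n \<alpha>) = ?e / \<alpha>"
    unfolding level_def using e assms by (simp add: exp_minus)
  ultimately show ?thesis using e assms by (simp add: field_simps)
qed

section \<open>Excursions over the observations with a given law\<close>

text \<open>
  In a sample of independent observations of which those with index in \<open>A\<close> have law \<open>D\<close>, whatever
  the law of the others, the walk climbs by \<open>level n \<alpha>\<close> within \<open>A\<close> with probability at most \<open>\<alpha>\<close>.
  The event depends on the coordinates in \<open>A\<close> only, which have the same joint law as in a sample
  with all observations from \<open>D\<close>; there it implies that the CUSUM process reaches the level.
\<close>

lemma prob_rise_within_le: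
  assumes M: "prob_space M" and indep: "prob_space.indep_vars M (\<lambda>_. \<mu>) X {1..n}"
    and A: "A \<subseteq> {1..n}" and D: "\<And>i. i \<in> A \<Longrightarrow> distr M \<mu> (X i) = D"
    and \<alpha>: "0 < \<alpha>"
  defines "E \<equiv> {\<omega>\<in>space M. \<exists>s t. s < t \<and> t \<le> n \<and> {s<..t} \<subseteq> A \<and>
      level n \<alpha> \<le> walk (\<lambda>i. X i \<omega>) t - walk (\<lambda>i. X i \<omega>) s}"
  shows "E \<in> sets M" and "measure M E \<le> \<alpha>"
proof -
  interpret M: prob_space M by fact
  interpret product_prob_space "\<lambda>_::nat. D" "{1..n}" by (rule product_prob_space_D)
  \<comment> \<open>Summing over \<open>{s<..t} \<inter> A\<close> makes \<open>Q\<close> measurable as a predicate on the coordinates in \<open>A\<close>.\<close>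
  define Q where "Q x \<longleftrightarrow> (\<exists>s\<in>{..n}. \<exists>t\<in>{..n}. s < t \<and> {s<..t} \<subseteq> A \<and>
      level n \<alpha> \<le> (\<Sum>i\<in>{s<..t} \<inter> A. \<phi> (x i)))" for x
  let ?X = "\<lambda>\<omega>. \<lambda>i\<in>A. X i \<omega>"
  have E: "E = {\<omega>\<in>space M. Q (?X \<omega>)}"
  proof -
    have eq: "level n \<alpha> \<le> walk (\<lambda>i. X i \<omega>) t - walk (\<lambda>i. X i \<omega>) s \<longleftrightarrow>
        level n \<alpha> \<le> (\<Sum>i\<in>{s<..t} \<inter> A. \<phi> (?X \<omega> i))" if "s < t" "{s<..t} \<subseteq> A" for s t \<omega>
      using that by (simp add: walk_diff Int_absorb2 subset_iff)
    have "(\<exists>s t. s < t \<and> t \<le> n \<and> {s<..t} \<subseteq> A \<and>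
        level n \<alpha> \<le> walk (\<lambda>i. X i \<omega>) t - walk (\<lambda>i. X i \<omega>) s) \<longleftrightarrow> Q (?X \<omega>)" (is "?L \<longleftrightarrow> _") for \<omega>
    proof
      assume ?L
      then obtain s t where "s < t" "t \<le> n" "{s<..t} \<subseteq> A"
          "level n \<alpha> \<le> walk (\<lambda>i. X i \<omega>) t - walk (\<lambda>i. X i \<omega>) s" by blast
      then show "Q (?X \<omega>)"
        unfolding Q_def using eq[of s t \<omega>] by (intro bexI[of _ s] bexI[of _ t] conjI) simp_all
    next
      assume "Q (?X \<omega>)"
      then obtain s t where "s < t" "t \<le> n" "{s<..t} \<subseteq> A"
          "level n \<alpha> \<le> (\<Sum>i\<in>{s<..t} \<inter> A. \<phi> (?X \<omega> i))"
        unfolding Q_def by blast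
      then show ?L using eq[of s t \<omega>] by blast
    qed
    then show ?thesis unfolding E_def by simp
  qed
  have Q_meas [measurable]: "Measurable.pred (P A) Q"
    unfolding Q_def by measurable
  have "E \<in> sets M \<and> measure M E \<le> \<alpha>"
  proof (cases "A = {}")
    case True
    then have "E = {}" unfolding E_def by force
    then show ?thesis using \<alpha> by simp
  next
    case False
    have indepA: "M.indep_vars (\<lambda>_. \<mu>) X A" using indep A by (rule M.indep_vars_subset)
    then have rv: "X i \<in> measurable M \<mu>" if "i \<in> A" for i
      using that unfolding M.indep_vars_def by auto
    have sD: "sets D = sets \<mu>" using D False by (metis sets_distr ex_in_conv)
    then have sP: "sets (PiM A (\<lambda>_. \<mu>)) = sets (P A)" by (intro sets_PiM_cong) auto
    have X: "?X \<in> measurable M (PiM A (\<lambda>_. \<mu>))"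
      using rv by (intro measurable_restrict)
    then have X' [measurable]: "?X \<in> measurable M (P A)"
      using sP by (simp cong: measurable_cong_sets)
    have "distr M (P A) ?X = distr M (PiM A (\<lambda>_. \<mu>)) ?X"
      using sP by (intro distr_cong) auto
    also have "\<dots> = PiM A (\<lambda>i. distr M \<mu> (X i))"
      using M.indep_vars_iff_distr_eq_PiM'[OF False rv] indepA by simp
    also have "\<dots> = P A" using D by (intro PiM_cong) auto
    finally have law: "distr M (P A) ?X = P A" .
    have lawP: "distr (P {1..n}) (P A) (\<lambda>x. restrict x A) = P A"
      using A by (intro distr_PiM_restrict_finite) (auto intro: finite_subset)
    have R [measurable]: "(\<lambda>x. restrict x A) \<in> measurable (P {1..n}) (P A)"
      using A by (rule measurable_restrict_subset)
    have "E = ?X -` {x\<in>space (P A). Q x} \<inter> space M"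
      using measurable_space[OF X'] unfolding E by auto
    then have "measure M E = measure (distr M (P A) ?X) {x\<in>space (P A). Q x}"
      by (simp add: measure_distr)
    also have "\<dots> = measure (distr (P {1..n}) (P A) (\<lambda>x. restrict x A)) {x\<in>space (P A). Q x}"
      unfolding law lawP ..
    also have "\<dots> = measure (P {1..n}) ((\<lambda>x. restrict x A) -` {x\<in>space (P A). Q x} \<inter> space (P {1..n}))"
      by (simp add: measure_distr)
    also have "\<dots> \<le> measure (P {1..n}) {x\<in>space (P {1..n}). \<exists>t\<le>n. level n \<alpha> \<le> W t x}"
    proof (rule P.finite_measure_mono)
      show "(\<lambda>x. restrict x A) -` {x\<in>space (P A). Q x} \<inter> space (P {1..n})
          \<subseteq> {x\<in>space (P {1..n}). \<exists>t\<le>n. level n \<alpha> \<le> W t x}"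
      proof clarify
        fix x assume "x \<in> space (P {1..n})" "Q (restrict x A)"
        then obtain s t where st: "s < t" "t \<le> n" "{s<..t} \<subseteq> A"
            "level n \<alpha> \<le> (\<Sum>i\<in>{s<..t} \<inter> A. \<phi> (restrict x A i))"
          unfolding Q_def by auto
        then have "level n \<alpha> \<le> walk x t - walk x s"
          by (simp add: walk_diff Int_absorb2 subset_iff)
        also have "\<dots> \<le> W t x" using cusum_ge_increment[of s t "walk x" 0] st by simp
        finally show "\<exists>t\<le>n. level n \<alpha> \<le> W t x" using st by auto
      qed
      have "{x\<in>space (P {1..n}). \<exists>t\<in>{..n}. level n \<alpha> \<le> W t x} \<in> sets (P {1..n})"
        by measurable
      then show "{x\<in>space (P {1..n}). \<exists>t\<le>n. level n \<alpha> \<le> W t x} \<in> sets (P {1..n})"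
        by (simp add: Bex_def)
    qed
    also have "\<dots> \<le> \<alpha>" by (rule prob_W_reaches_level_le[OF \<alpha>])
    finally have "measure M E \<le> \<alpha>" .
    moreover have "E \<in> sets M" unfolding E by measurable
    ultimately show ?thesis by blast
  qed
  then show "E \<in> sets M" "measure M E \<le> \<alpha>" by auto
qed

text \<open>The event \<open>B\<close> itself need not be measurable.\<close>

lemma prob_le_of_imp_rise_within:
  assumes "prob_space M" "prob_space.indep_vars M (\<lambda>_. \<mu>) X {1..n}"
    and "A \<subseteq> {1..n}" "\<And>i. i \<in> A \<Longrightarrow> distr M \<mu> (X i) = D" "0 < \<alpha>"
    and "\<And>\<omega>. \<omega> \<in> B \<Longrightarrow> \<omega> \<in> space M"
    and "\<And>\<omega>. \<omega> \<in> B \<Longrightarrow> \<exists>s t. s < t \<and> t \<le> n \<and> {s<..t} \<subseteq> A \<and>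
      level n \<alpha> \<le> walk (\<lambda>i. X i \<omega>) t - walk (\<lambda>i. X i \<omega>) s"
  shows "measure M B \<le> \<alpha>"
proof -
  interpret M: prob_space M by fact
  note rise = prob_rise_within_le[OF assms(1-5)]
  have "measure M B \<le> measure M {\<omega>\<in>space M. \<exists>s t. s < t \<and> t \<le> n \<and> {s<..t} \<subseteq> A \<and>
      level n \<alpha> \<le> walk (\<lambda>i. X i \<omega>) t - walk (\<lambda>i. X i \<omega>) s}"
    by (rule M.finite_measure_mono[OF _ rise(1)]) (use assms(6,7) in auto)
  also note rise(2)
  finally show ?thesis .
qed

end

section \<open>The log-likelihood ratio\<close>

text \<open>
  The function \<open>\<phi>\<close> has to be the log-likelihood ratio only where both densities are positive; the
  remaining points form a null set under either law.
\<close>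

lemma nn_integral_likelihood_ratio:
  fixes p q :: "'b \<Rightarrow> real"
  assumes [measurable]: "p \<in> borel_measurable \<mu>" "q \<in> borel_measurable \<mu>" "\<phi> \<in> borel_measurable \<mu>"
    and q: "prob_space (density \<mu> (\<lambda>y. ennreal (q y)))" "\<And>y. y \<in> space \<mu> \<Longrightarrow> 0 \<le> q y"
    and p: "\<And>y. y \<in> space \<mu> \<Longrightarrow> 0 \<le> p y"
    and supp: "AE y in \<mu>. 0 < p y \<longleftrightarrow> 0 < q y"
    and \<phi>: "\<And>y. 0 < p y \<Longrightarrow> 0 < q y \<Longrightarrow> exp (\<phi> y) = q y / p y"
  shows "(\<integral>\<^sup>+y. ennreal (exp (\<phi> y)) \<partial>density \<mu> (\<lambda>y. ennreal (p y))) = 1"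
proof -
  have "(\<integral>\<^sup>+y. ennreal (exp (\<phi> y)) \<partial>density \<mu> (\<lambda>y. ennreal (p y)))
      = (\<integral>\<^sup>+y. ennreal (p y) * ennreal (exp (\<phi> y)) \<partial>\<mu>)"
    by (rule nn_integral_density) measurable
  also have "\<dots> = (\<integral>\<^sup>+y. ennreal (q y) \<partial>\<mu>)"
  proof (rule nn_integral_cong_AE)
    show "AE y in \<mu>. ennreal (p y) * ennreal (exp (\<phi> y)) = ennreal (q y)"
      using supp AE_space
    proof eventually_elim
      case (elim y)
      show ?case
      proof (cases "0 < p y")
        case True
        then show ?thesis using elim \<phi>[of y] by (simp add: ennreal_mult[symmetric])
      next
        case False
        then have "p y = 0" "q y = 0" using elim p[of y] q(2)[of y] by auto
        then show ?thesis by simp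
      qed
    qed
  qed
  also have "\<dots> = emeasure (density \<mu> (\<lambda>y. ennreal (q y))) (space \<mu>)"
    by (subst emeasure_density) (auto intro!: nn_integral_cong)
  also have "\<dots> = 1" using prob_space.emeasure_space_1[OF q(1)] by simp
  finally show ?thesis .
qed


theorem proposition4p1:
  fixes M :: "'a measure" and \<mu> :: "'b measure"
    and f g :: "'b \<Rightarrow> real" and X :: "nat \<Rightarrow> 'a \<Rightarrow> 'b"
    and n K :: nat and a b :: "nat \<Rightarrow> nat" and \<alpha> \<beta> :: real
  assumes "prob_space M"
    and "f \<in> borel_measurable \<mu>" and "g \<in> borel_measurable \<mu>"
    and "\<And>x. x \<in> space \<mu> \<Longrightarrow> 0 \<le> f x" and "\<And>x. x \<in> space \<mu> \<Longrightarrow> 0 \<le> g x"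
    and "prob_space (density \<mu> (\<lambda>x. ennreal (f x)))"
    and "prob_space (density \<mu> (\<lambda>x. ennreal (g x)))"
    and "AE x in \<mu>. 0 < f x \<longleftrightarrow> 0 < g x"
    and "\<And>k. k \<in> {1..K} \<Longrightarrow> a k < b k"
    and "\<And>k. k \<in> {1..<K} \<Longrightarrow> b k < a (k + 1)"
    and "\<And>k. k \<in> {1..K} \<Longrightarrow> b k \<le> n"
    and "prob_space.indep_vars M (\<lambda>_. \<mu>) X {1..n}"
    and "\<And>i. i \<in> {1..n} \<Longrightarrow> \<exists>k\<in>{1..K}. a k < i \<and> i \<le> b k \<Longrightarrow>
           distributed M \<mu> (X i) (\<lambda>x. ennreal (g x))"
    and "\<And>i. i \<in> {1..n} \<Longrightarrow> \<not> (\<exists>k\<in>{1..K}. a k < i \<and> i \<le> b k) \<Longrightarrow>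
           distributed M \<mu> (X i) (\<lambda>x. ennreal (f x))"
    and "0 < \<alpha>" and "\<alpha> < 1" and "0 < \<beta>" and "\<beta> < 1"
  shows "FAR M f g n X (h_alarm \<mu> f g n \<alpha>) (h_readjust \<mu> f g n \<beta>) K a b \<le> \<alpha>
       \<and> FRR M f g n X (h_alarm \<mu> f g n \<alpha>) (h_readjust \<mu> f g n \<beta>) K a b \<le> \<beta>"
proof
  interpret M: prob_space M by fact
  note [measurable] = assms(2,3)
  let ?F = "density \<mu> (\<lambda>y. ennreal (f y))" and ?G = "density \<mu> (\<lambda>y. ennreal (g y))"
  let ?\<phi> = "\<lambda>y. ln (g y / f y)" and ?\<psi> = "\<lambda>y. - ln (g y / f y)"
  have "(\<integral>\<^sup>+y. ennreal (exp (?\<phi> y)) \<partial>?F) = 1"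
    by (rule nn_integral_likelihood_ratio[where q=g]) (use assms in auto)
  then interpret F: iid_score ?F ?\<phi>
    using assms(6) by (intro iid_score.intro iid_score_axioms.intro) auto
  have "(\<integral>\<^sup>+y. ennreal (exp (?\<psi> y)) \<partial>?G) = 1"
    by (rule nn_integral_likelihood_ratio[where q=f]) (use assms in \<open>auto simp: exp_minus\<close>)
  then interpret G: iid_score ?G ?\<psi>
    using assms(7) by (intro iid_score.intro iid_score_axioms.intro) auto
  let ?S = "llr_walk f g"
  have S: "?S x = F.walk x" "(\<lambda>t. - ?S x t) = G.walk x" for x
    by (simp_all add: llr_walk_def F.walk_def G.walk_def fun_eq_iff sum_negf)
  have h: "h_alarm \<mu> f g n \<alpha> = F.level n \<alpha>"
    by (simp add: h_alarm_def E_iid_def F.level_def S)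
  have h': "h_readjust \<mu> f g n \<beta> = G.level n \<beta>"
    by (simp add: h_readjust_def E_iid_def G.level_def cusum_rev_eq_cusum_uminus S(2))
  define C where "C = {i\<in>{1..n}. \<exists>k\<in>{1..K}. a k < i \<and> i \<le> b k}"
  show "FAR M f g n X (h_alarm \<mu> f g n \<alpha>) (h_readjust \<mu> f g n \<beta>) K a b \<le> \<alpha>"
    unfolding FAR_def
  proof (rule F.prob_le_of_imp_rise_within[of M \<mu> X n "{1..n} - C"])
    fix \<omega> assume "\<omega> \<in> {\<omega>\<in>space M. false_alarm n (?S (\<lambda>i. X i \<omega>)) (h_alarm \<mu> f g n \<alpha>)
        (h_readjust \<mu> f g n \<beta>) K a b}"
    then have "false_alarm n (F.walk (\<lambda>i. X i \<omega>)) (F.level n \<alpha>) (h_readjust \<mu> f g n \<beta>) K a b"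
      unfolding h S(1) by simp
    from false_alarm_imp_rise[OF F.level_pos[OF assms(15,16)] this]
    obtain s t where st: "s < t" "t \<le> n" "{s<..t} \<inter> (\<Union>j\<in>{1..K}. {a j..b j}) = {}"
        "F.level n \<alpha> \<le> F.walk (\<lambda>i. X i \<omega>) t - F.walk (\<lambda>i. X i \<omega>) s"
      by (elim exE conjE)
    have "{s<..t} \<subseteq> {1..n} - C"
      using st(2,3) by (fastforce simp: C_def)
    with st show "\<exists>s t. s < t \<and> t \<le> n \<and> {s<..t} \<subseteq> {1..n} - C \<and>
        F.level n \<alpha> \<le> F.walk (\<lambda>i. X i \<omega>) t - F.walk (\<lambda>i. X i \<omega>) s" by blast
  qed (use assms(1,12,14,15) in \<open>auto simp: C_def distributed_def\<close>)
  show "FRR M f g n X (h_alarm \<mu> f g n \<alpha>) (h_readjust \<mu> f g n \<beta>) K a b \<le> \<beta>"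
    unfolding FRR_def
  proof (rule G.prob_le_of_imp_rise_within[of M \<mu> X n C])
    fix \<omega> assume "\<omega> \<in> {\<omega>\<in>space M. false_readjustment n (?S (\<lambda>i. X i \<omega>)) (h_alarm \<mu> f g n \<alpha>)
        (h_readjust \<mu> f g n \<beta>) K a b}"
    then have "false_readjustment n (?S (\<lambda>i. X i \<omega>)) (h_alarm \<mu> f g n \<alpha>) (G.level n \<beta>) K a b"
      unfolding h' by simp
    from false_readjustment_imp_drop[OF G.level_pos[OF assms(17,18)] this]
    obtain s t where st: "s < t" "t \<le> n" "{s<..t} \<inter> in_control_region n K a b = {}"
        "G.level n \<beta> \<le> ?S (\<lambda>i. X i \<omega>) s - ?S (\<lambda>i. X i \<omega>) t"
      by (elim exE conjE)
    have "{s<..t} \<subseteq> C"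
    proof
      fix i assume "i \<in> {s<..t}"
      then have "i \<in> {1..n}" "i \<notin> in_control_region n K a b" using st(2,3) by auto
      then show "i \<in> C" using in_disorder_if_not_in_control by (simp add: C_def)
    qed
    moreover have "G.level n \<beta> \<le> G.walk (\<lambda>i. X i \<omega>) t - G.walk (\<lambda>i. X i \<omega>) s"
      using st(4) unfolding S(2)[symmetric] by simp
    ultimately show "\<exists>s t. s < t \<and> t \<le> n \<and> {s<..t} \<subseteq> C \<and>
        G.level n \<beta> \<le> G.walk (\<lambda>i. X i \<omega>) t - G.walk (\<lambda>i. X i \<omega>) s" using st by blast
  qed (use assms(1,12,13,17) in \<open>auto simp: C_def distributed_def\<close>)
qed

end
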